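(* For $k=1,2$, let $G_k=(V_k,E_k)$ be a uniformly colored graph of type $(p_k,q_k,r_k)$ with degree $s_k$, and let $c_k:E_k\to S_k$ be its coloring function. Assume that the graphs $G_1$ and $G_2$ are disjoint and that the coloring sets $S_1$ and $S_2$ are disjoint. Define $c:E_1\cup E_2\to S_1\cup S_2$ by $c(e)=c_1(e)$ if $e\in E_1$ and $c(e)=c_2(e)$ if $e\in E_2$. Then the following are equivalent: (1) the disjoint union $G_1+G_2=(V_1\cup V_2,E_1\cup E_2)$, endowed with the coloring function $c$, is a uniformly colored graph; (2) $s_1=s_2$ and $r_1=r_2$. Furthermore, if $G_1+G_2$ endowed with $c$ is uniformly colored, then it is of type $(p_1+p_2,q_1+q_2,r)$, where $r=r_1=r_2$, and it has degree $s=s_1=s_2$.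
   Context: Graphs have no loops or multiple edges. A uniform edge coloring of type $(p,q,r)$ ($p,q,r$ positive integers) with degree $s\ge 1$ on an undirected $s$-regular graph $(V,E)$ with $q$ vertices is a surjective map $c:E\to S$, $|S|=p$, such that adjacent edges have different colors (the coloring is proper) and $|c^{-1}(\{k\})|=r$ for every $k\in S$. A uniformly colored graph of type $(p,q,r)$ is a graph with such a coloring; a directed graph is uniformly colored of type $(p,q,r)$ if it is an undirected uniformly colored graph of type $(p,q,r)$ endowed with an orientation. *)

theory Defs
  imports Main
begin

type_synonym 'a ugraph = "'a set \<times> 'a set set"

abbreviation vertices :: "'a ugraph \<Rightarrow> 'a set" where
  "vertices G \<equiv> fst G"

abbreviation edges :: "'a ugraph \<Rightarrow> 'a set set" where
  "edges G \<equiv> snd G"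

text \<open>An undirected edge is a two-element set of vertices, which rules out loops and multiple edges.\<close>

definition simple_graph :: "'a ugraph \<Rightarrow> bool" where
  "simple_graph G \<longleftrightarrow> finite (vertices G) \<and> (\<forall>e\<in>edges G. e \<subseteq> vertices G \<and> card e = 2)"

definition vertex_degree :: "'a ugraph \<Rightarrow> 'a \<Rightarrow> nat" where
  "vertex_degree G v = card {e \<in> edges G. v \<in> e}"

definition regular_graph :: "nat \<Rightarrow> 'a ugraph \<Rightarrow> bool" where
  "regular_graph s G \<longleftrightarrow> simple_graph G \<and> (\<forall>v\<in>vertices G. vertex_degree G v = s)"

definition proper_edge_coloring :: "'a ugraph \<Rightarrow> ('a set \<Rightarrow> 'c) \<Rightarrow> bool" where
  "proper_edge_coloring G c \<longleftrightarrow>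
    (\<forall>e\<in>edges G. \<forall>f\<in>edges G. e \<noteq> f \<and> e \<inter> f \<noteq> {} \<longrightarrow> c e \<noteq> c f)"

text \<open>A coloring \<open>c : E \<rightarrow> S\<close> is a total function of which only the values on \<open>E\<close> matter;
  \<open>c ` E = S\<close> says both that it maps into \<open>S\<close> and that it is surjective.\<close>

definition uniform_edge_coloring ::
  "'a ugraph \<Rightarrow> 'c set \<Rightarrow> ('a set \<Rightarrow> 'c) \<Rightarrow> nat \<times> nat \<times> nat \<Rightarrow> nat \<Rightarrow> bool" where
  "uniform_edge_coloring G S c = (\<lambda>(p, q, r) s.
    p > 0 \<and> q > 0 \<and> r > 0 \<and> s \<ge> 1 \<and>
    regular_graph s G \<and> card (vertices G) = q \<and>
    finite S \<and> card S = p \<and> c ` edges G = S \<and>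
    proper_edge_coloring G c \<and>
    (\<forall>k\<in>S. card {e \<in> edges G. c e = k} = r))"

definition uniformly_colored_graph :: "'a ugraph \<Rightarrow> 'c set \<Rightarrow> ('a set \<Rightarrow> 'c) \<Rightarrow> bool" where
  "uniformly_colored_graph G S c \<longleftrightarrow> (\<exists>p q r s. uniform_edge_coloring G S c (p, q, r) s)"

definition graph_union :: "'a ugraph \<Rightarrow> 'a ugraph \<Rightarrow> 'a ugraph" where
  "graph_union G H = (vertices G \<union> vertices H, edges G \<union> edges H)"

end

theory Submission
  imports Defs
begin

text \<open>Degree and color multiplicity can be read off locally, and a disjoint union changes
  neither. An edge of one graph contains no vertex of the other, so vertex degrees survive
  (\<open>vertex_degree_graph_union\<close>). The color sets are disjoint, so color classes survive
  as well (\<open>color_class_graph_union\<close>). Hence if the union is uniform with degree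
  \<open>s\<close> and multiplicity \<open>r\<close>, one vertex and one color of each summand force
  both summands to have these same parameters (\<open>uniform_graph_union_parameters\<close>).
  Conversely, if the parameters agree, every vertex and every color of the union inherits the common
  value, edges from different summands never share a color, and the numbers of vertices and colors
  add up (\<open>uniform_edge_coloring_graph_union\<close>). The latter also gives the type of the
  union. The lemmas on degrees and color classes favor the first summand;
  \<open>graph_union_commute\<close> transfers them to the second.\<close>

lemma graph_union_commute: "graph_union G H = graph_union H G"
  by (auto simp: graph_union_def)

text \<open>Edges of a simple graph are subsets of its vertex set, so no edge of \<open>H\<close>
  contributes to the degree of a vertex outside \<open>H\<close>.\<close>

lemma vertex_degree_graph_union:
  assumes "simple_graph H" and "v \<notin> vertices H"
  shows "vertex_degree (graph_union G H) v = vertex_degree G v"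
proof -
  have "{e \<in> edges (graph_union G H). v \<in> e} = {e \<in> edges G. v \<in> e}"
    using assms by (auto simp: graph_union_def simple_graph_def)
  then show ?thesis
    by (simp add: vertex_degree_def)
qed

lemma color_class_graph_union:
  assumes "k \<notin> c ` edges H"
  shows "{e \<in> edges (graph_union G H). c e = k} = {e \<in> edges G. c e = k}"
  using assms by (auto simp: graph_union_def)

text \<open>The necessity direction for a single summand. Applied to both orders of the union, it
  compares each summand with the same \<open>s'\<close> and \<open>r'\<close>.\<close>

lemma uniform_graph_union_parameters:
  assumes "uniform_edge_coloring G S c (p, q, r) s"
    and "simple_graph H" and "vertices G \<inter> vertices H = {}"
    and "S \<inter> c ` edges H = {}"
    and "uniform_edge_coloring (graph_union G H) (S \<union> T) c (p', q', r') s'"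
  shows "s = s'" and "r = r'"
proof -
  \<comment> \<open>A test vertex exists because \<open>q > 0\<close> is the number of vertices;
    likewise \<open>p > 0\<close> will supply a test color.\<close>
  obtain v where v: "v \<in> vertices G"
    using assms(1) by (fastforce simp: uniform_edge_coloring_def)
  then have "vertex_degree (graph_union G H) v = vertex_degree G v"
    using assms(2,3) by (intro vertex_degree_graph_union) auto
  moreover have "v \<in> vertices (graph_union G H)"
    using v by (simp add: graph_union_def)
  ultimately show "s = s'"
    using v assms(1,5) by (auto simp: uniform_edge_coloring_def regular_graph_def)
  obtain k where k: "k \<in> S"
    using assms(1) by (fastforce simp: uniform_edge_coloring_def)
  then have "{e \<in> edges (graph_union G H). c e = k} = {e \<in> edges G. c e = k}"
    using assms(4) by (intro color_class_graph_union) auto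
  moreover have "card {e \<in> edges G. c e = k} = r"
    using k assms(1) by (simp add: uniform_edge_coloring_def)
  moreover have "card {e \<in> edges (graph_union G H). c e = k} = r'"
    using k assms(5) by (simp add: uniform_edge_coloring_def)
  ultimately show "r = r'"
    by simp
qed

lemma regular_graph_union:
  assumes "regular_graph s G" and "regular_graph s H" and "vertices G \<inter> vertices H = {}"
  shows "regular_graph s (graph_union G H)"
  unfolding regular_graph_def
proof (intro conjI ballI)
  show "simple_graph (graph_union G H)"
    using assms by (auto simp: regular_graph_def simple_graph_def graph_union_def)
next
  fix v
  assume "v \<in> vertices (graph_union G H)"
  then consider "v \<in> vertices G" "v \<notin> vertices H" | "v \<in> vertices H" "v \<notin> vertices G"
    using assms(3) by (auto simp: graph_union_def)
  then show "vertex_degree (graph_union G H) v = s"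
  proof cases
    case 1
    then show ?thesis
      using assms by (simp add: regular_graph_def vertex_degree_graph_union)
  next
    case 2
    then show ?thesis
      using assms by (simp add: regular_graph_def vertex_degree_graph_union graph_union_commute[of G])
  qed
qed

text \<open>Edges from different graphs receive different colors because the images are disjoint, so
  a conflict could only occur inside one of the graphs.\<close>

lemma proper_edge_coloring_graph_union:
  assumes "proper_edge_coloring G c" and "proper_edge_coloring H c"
    and "c ` edges G \<inter> c ` edges H = {}"
  shows "proper_edge_coloring (graph_union G H) c"
  using assms unfolding proper_edge_coloring_def graph_union_def by (auto; blast)

text \<open>Only the values on edges matter. This allows the glued coloring to replace the two given
  ones, so that both summands carry the same function.\<close>

lemma uniform_edge_coloring_cong:
  assumes "\<forall>e\<in>edges G. c e = d e"
  shows "uniform_edge_coloring G S c t s \<longleftrightarrow> uniform_edge_coloring G S d t s"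
proof -
  have "c ` edges G = d ` edges G"
    using assms by auto
  moreover have "{e \<in> edges G. c e = k} = {e \<in> edges G. d e = k}" for k
    using assms by auto
  moreover have "proper_edge_coloring G c \<longleftrightarrow> proper_edge_coloring G d"
    using assms by (simp add: proper_edge_coloring_def)
  ultimately show ?thesis
    by (simp add: uniform_edge_coloring_def)
qed

text \<open>The sufficiency direction: equality of the parameters is expressed by the shared
  \<open>r\<close> and \<open>s\<close> in \<open>G\<close> and \<open>H\<close>.\<close>

lemma uniform_edge_coloring_graph_union:
  assumes G: "uniform_edge_coloring G S c (p, q, r) s"
    and H: "uniform_edge_coloring H T c (p', q', r) s"
    and V: "vertices G \<inter> vertices H = {}" and ST: "S \<inter> T = {}"
  shows "uniform_edge_coloring (graph_union G H) (S \<union> T) c (p + p', q + q', r) s"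
proof -
  have im: "c ` edges G = S" "c ` edges H = T"
    using G H by (auto simp: uniform_edge_coloring_def)
  have "finite (vertices G)" "finite (vertices H)"
    using G H by (auto simp: uniform_edge_coloring_def regular_graph_def simple_graph_def)
  then have "card (vertices (graph_union G H)) = q + q'"
    using G H V by (simp add: graph_union_def card_Un_disjoint uniform_edge_coloring_def)
  moreover have "card (S \<union> T) = p + p'"
    using G H ST by (simp add: card_Un_disjoint uniform_edge_coloring_def)
  moreover have "regular_graph s (graph_union G H)"
    using G H V by (intro regular_graph_union) (auto simp: uniform_edge_coloring_def)
  moreover have "proper_edge_coloring (graph_union G H) c"
    using G H ST im by (intro proper_edge_coloring_graph_union) (auto simp: uniform_edge_coloring_def)
  moreover have "card {e \<in> edges (graph_union G H). c e = k} = r" if "k \<in> S \<union> T" for k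
  proof (cases "k \<in> S")
    case True
    then have "{e \<in> edges (graph_union G H). c e = k} = {e \<in> edges G. c e = k}"
      using ST im by (intro color_class_graph_union) auto
    then show ?thesis
      using True G by (simp add: uniform_edge_coloring_def)
  next
    case False
    \<comment> \<open>Here \<open>k\<close> is a color of \<open>H\<close> outside \<open>S\<close>,
      the image of the edges of \<open>G\<close>, so the summands exchange roles.\<close>
    then have "{e \<in> edges (graph_union H G). c e = k} = {e \<in> edges H. c e = k}"
      using im by (intro color_class_graph_union) auto
    then show ?thesis
      using False that H by (simp add: uniform_edge_coloring_def graph_union_commute[of G])
  qed
  moreover have "c ` edges (graph_union G H) = S \<union> T"
    using im by (simp add: graph_union_def image_Un)
  ultimately show ?thesis
    using G H by (simp add: uniform_edge_coloring_def)
qed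

theorem proposition4p18:
  fixes G\<^sub>1 G\<^sub>2 :: "'a ugraph"
    and S\<^sub>1 S\<^sub>2 :: "'c set"
    and c\<^sub>1 c\<^sub>2 c :: "'a set \<Rightarrow> 'c"
    and p\<^sub>1 q\<^sub>1 r\<^sub>1 s\<^sub>1 p\<^sub>2 q\<^sub>2 r\<^sub>2 s\<^sub>2 :: nat
  assumes "uniform_edge_coloring G\<^sub>1 S\<^sub>1 c\<^sub>1 (p\<^sub>1, q\<^sub>1, r\<^sub>1) s\<^sub>1"
    and "uniform_edge_coloring G\<^sub>2 S\<^sub>2 c\<^sub>2 (p\<^sub>2, q\<^sub>2, r\<^sub>2) s\<^sub>2"
    and "vertices G\<^sub>1 \<inter> vertices G\<^sub>2 = {}"
    and "S\<^sub>1 \<inter> S\<^sub>2 = {}"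
    and "\<forall>e\<in>edges G\<^sub>1. c e = c\<^sub>1 e"
    and "\<forall>e\<in>edges G\<^sub>2. c e = c\<^sub>2 e"
  shows "(uniformly_colored_graph (graph_union G\<^sub>1 G\<^sub>2) (S\<^sub>1 \<union> S\<^sub>2) c \<longleftrightarrow> s\<^sub>1 = s\<^sub>2 \<and> r\<^sub>1 = r\<^sub>2) \<and>
    (uniformly_colored_graph (graph_union G\<^sub>1 G\<^sub>2) (S\<^sub>1 \<union> S\<^sub>2) c \<longrightarrow>
      (\<exists>r s. r = r\<^sub>1 \<and> r = r\<^sub>2 \<and> s = s\<^sub>1 \<and> s = s\<^sub>2 \<and>
        uniform_edge_coloring (graph_union G\<^sub>1 G\<^sub>2) (S\<^sub>1 \<union> S\<^sub>2) c
          (p\<^sub>1 + p\<^sub>2, q\<^sub>1 + q\<^sub>2, r) s))"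
proof -
  let ?G = "graph_union G\<^sub>1 G\<^sub>2" and ?S = "S\<^sub>1 \<union> S\<^sub>2"
  have c: "uniform_edge_coloring G\<^sub>1 S\<^sub>1 c (p\<^sub>1, q\<^sub>1, r\<^sub>1) s\<^sub>1"
    "uniform_edge_coloring G\<^sub>2 S\<^sub>2 c (p\<^sub>2, q\<^sub>2, r\<^sub>2) s\<^sub>2"
    using assms(1,2) uniform_edge_coloring_cong[OF assms(5)] uniform_edge_coloring_cong[OF assms(6)]
    by simp_all
  then have simple: "simple_graph G\<^sub>1" "simple_graph G\<^sub>2"
    and im: "c ` edges G\<^sub>1 = S\<^sub>1" "c ` edges G\<^sub>2 = S\<^sub>2"
    by (auto simp: uniform_edge_coloring_def regular_graph_def)
  have params: "s\<^sub>1 = s\<^sub>2 \<and> r\<^sub>1 = r\<^sub>2" if "uniformly_colored_graph ?G ?S c"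
  proof -
    obtain p q r s where u: "uniform_edge_coloring ?G ?S c (p, q, r) s"
      using \<open>uniformly_colored_graph ?G ?S c\<close> by (auto simp: uniformly_colored_graph_def)
    \<comment> \<open>The same coloring of the same union, with the second graph placed first so
      that its parameters can be compared too.\<close>
    then have u': "uniform_edge_coloring (graph_union G\<^sub>2 G\<^sub>1) (S\<^sub>2 \<union> S\<^sub>1) c (p, q, r) s"
      by (simp add: graph_union_commute Un_commute)
    have "s\<^sub>1 = s" "r\<^sub>1 = r"
      using uniform_graph_union_parameters[OF c(1) simple(2) _ _ u] assms(3,4) im by auto
    moreover have "s\<^sub>2 = s" "r\<^sub>2 = r"
      using uniform_graph_union_parameters[OF c(2) simple(1) _ _ u'] assms(3,4) im by auto
    ultimately show ?thesis
      by simp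
  qed
  have union: "uniform_edge_coloring ?G ?S c (p\<^sub>1 + p\<^sub>2, q\<^sub>1 + q\<^sub>2, r\<^sub>1) s\<^sub>1"
    if "s\<^sub>1 = s\<^sub>2 \<and> r\<^sub>1 = r\<^sub>2"
    using that c assms(3,4) by (intro uniform_edge_coloring_graph_union) auto
  then have "uniformly_colored_graph ?G ?S c" if "s\<^sub>1 = s\<^sub>2 \<and> r\<^sub>1 = r\<^sub>2"
    using that unfolding uniformly_colored_graph_def by blast
  with params union show ?thesis
    by blast
qed

end
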